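(* Let $A$ be a complex commutative semi-simple regular Banach algebra, and let $\sigma : A \rightarrow A$ be an automorphism. Then every non-zero ideal $I$ in $A \rtimes_{\sigma} \mathbb{Z}$ has non-zero intersection with the commutant $A'$ of $A$ in $A \rtimes_{\sigma} \mathbb{Z}$, that is, $I \cap A' \neq \{0\}$.
   Context: $\Delta(A)$ denotes the character space of $A$ (the non-zero complex algebra homomorphisms $A \to \mathbb{C}$) with the Gelfand topology, i.e. the weakest topology making all Gelfand transforms $\widehat{a}$, $\widehat{a}(\mu) = \mu(a)$, $a \in A$, continuous. A commutative Banach algebra $A$ (not assumed unital) is semi-simple if the Gelfand transform $a \mapsto \widehat{a}$ is injective; it is regular if for every closed $F \subseteq \Delta(A)$ and every $\phi_0 \in \Delta(A) \setminus F$ there is $a \in A$ with $\widehat{a}(\phi) = 0$ for all $\phi \in F$ and $\widehat{a}(\phi_0) \neq 0$. "Automorphism" means algebra automorphism. The crossed product $A \rtimes_{\sigma} \mathbb{Z}$ is the purely algebraic one: the set of functions $f : \mathbb{Z} \to A$ with $f(n) = 0$ for all but finitely many $n$, with pointwise addition and scalar multiplication and multiplication given by twisted convolution $(f*g)(n) = \sum_{k \in \mathbb{Z}} f(k) \cdot \sigma^k(g(n-k))$. Elements are written as finite sums $\sum_{n} f_n \delta^n$ with $f_n = f(n)$. The algebra $A$ is identified with the subalgebra $\{a \delta^0 : a \in A\}$ of $A \rtimes_{\sigma} \mathbb{Z}$, and $A'$ is the set of elements of $A \rtimes_{\sigma} \mathbb{Z}$ commuting with every element of this subalgebra. Ideals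 are two-sided. *)

theory Defs
  imports "HOL-Analysis.Analysis"
begin

text \<open>
  The real structure inherited from \<open>real_normed_algebra\<close> is the restriction of the complex one.
  No unit is assumed, and the zero algebra is allowed.
\<close>

class complex_comm_banach_algebra = real_normed_algebra + comm_ring + banach +
  fixes scaleC :: "complex \<Rightarrow> 'a \<Rightarrow> 'a"  (infixr \<open>*\<^sub>C\<close> 75)
  assumes scaleC_add_right: "c *\<^sub>C (x + y) = c *\<^sub>C x + c *\<^sub>C y"
    and scaleC_add_left: "(c + d) *\<^sub>C x = c *\<^sub>C x + d *\<^sub>C x"
    and scaleC_scaleC: "c *\<^sub>C d *\<^sub>C x = (c * d) *\<^sub>C x"
    and scaleC_one: "1 *\<^sub>C x = x"
    and scaleR_scaleC: "r *\<^sub>R x = complex_of_real r *\<^sub>C x"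
    and mult_scaleC_left: "(c *\<^sub>C x) * y = c *\<^sub>C (x * y)"
    and norm_scaleC: "norm (c *\<^sub>C x) = cmod c * norm x"

definition character_space :: "('a::complex_comm_banach_algebra \<Rightarrow> complex) set" where
  "character_space = {\<phi>. (\<forall>x y. \<phi> (x + y) = \<phi> x + \<phi> y) \<and>
                         (\<forall>c x. \<phi> (c *\<^sub>C x) = c * \<phi> x) \<and>
                         (\<forall>x y. \<phi> (x * y) = \<phi> x * \<phi> y) \<and>
                         (\<exists>x. \<phi> x \<noteq> 0)}"

definition gelfand_transform ::
    "'a::complex_comm_banach_algebra \<Rightarrow> ('a \<Rightarrow> complex) \<Rightarrow> complex" where
  "gelfand_transform a = (\<lambda>\<phi>\<in>character_space. \<phi> a)"

definition gelfand_topology :: "('a::complex_comm_banach_algebra \<Rightarrow> complex) topology" where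
  "gelfand_topology =
     topology_generated_by
       {{\<phi> \<in> character_space. gelfand_transform a \<phi> \<in> V} | a V. open V}"

definition semisimple :: "'a::complex_comm_banach_algebra itself \<Rightarrow> bool" where
  "semisimple _ \<longleftrightarrow> inj (gelfand_transform :: 'a \<Rightarrow> _)"

definition regular :: "'a::complex_comm_banach_algebra itself \<Rightarrow> bool" where
  "regular _ \<longleftrightarrow>
     (\<forall>F (\<phi>\<^sub>0 :: 'a \<Rightarrow> complex).
        closedin gelfand_topology F \<longrightarrow> \<phi>\<^sub>0 \<in> character_space - F \<longrightarrow>
        (\<exists>a. (\<forall>\<phi>\<in>F. gelfand_transform a \<phi> = 0) \<and> gelfand_transform a \<phi>\<^sub>0 \<noteq> 0))"

definition algebra_automorphism :: "('a::complex_comm_banach_algebra \<Rightarrow> 'a) \<Rightarrow> bool" where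
  "algebra_automorphism \<sigma> \<longleftrightarrow>
     bij \<sigma> \<and>
     (\<forall>x y. \<sigma> (x + y) = \<sigma> x + \<sigma> y) \<and>
     (\<forall>c x. \<sigma> (c *\<^sub>C x) = c *\<^sub>C \<sigma> x) \<and>
     (\<forall>x y. \<sigma> (x * y) = \<sigma> x * \<sigma> y)"

definition int_iterate :: "('a \<Rightarrow> 'a) \<Rightarrow> int \<Rightarrow> 'a \<Rightarrow> 'a" where
  "int_iterate \<sigma> k = (if k \<ge> 0 then \<sigma> ^^ nat k else inv \<sigma> ^^ nat (- k))"

text \<open>
  The elements of the crossed product do not depend on the automorphism; only the product does.
\<close>

definition crossed_product :: "(int \<Rightarrow> 'a::complex_comm_banach_algebra) set" where
  "crossed_product = {f. finite {n. f n \<noteq> 0}}"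

text \<open>
  The sum over all integers \<open>k\<close> is restricted to the finite support of \<open>f\<close>, outside which
  the summands vanish.
\<close>

definition cp_mult ::
    "('a \<Rightarrow> 'a) \<Rightarrow> (int \<Rightarrow> 'a) \<Rightarrow> (int \<Rightarrow> 'a) \<Rightarrow> int \<Rightarrow> 'a::complex_comm_banach_algebra" where
  "cp_mult \<sigma> f g = (\<lambda>n. \<Sum>k | f k \<noteq> 0. f k * int_iterate \<sigma> k (g (n - k)))"

definition cp_embed :: "'a::complex_comm_banach_algebra \<Rightarrow> int \<Rightarrow> 'a" where
  "cp_embed a = (\<lambda>n. if n = 0 then a else 0)"

definition cp_commutant ::
    "('a::complex_comm_banach_algebra \<Rightarrow> 'a) \<Rightarrow> (int \<Rightarrow> 'a) set" where
  "cp_commutant \<sigma> =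
     {f \<in> crossed_product. \<forall>a. cp_mult \<sigma> f (cp_embed a) = cp_mult \<sigma> (cp_embed a) f}"

text \<open>
  Ideals of the algebra, hence complex subspaces: without a unit, closure under
  scalars does not follow from absorption.
\<close>

definition cp_ideal ::
    "('a::complex_comm_banach_algebra \<Rightarrow> 'a) \<Rightarrow> (int \<Rightarrow> 'a) set \<Rightarrow> bool" where
  "cp_ideal \<sigma> I \<longleftrightarrow>
     I \<subseteq> crossed_product \<and>
     (\<lambda>_. 0) \<in> I \<and>
     (\<forall>f\<in>I. \<forall>g\<in>I. (\<lambda>n. f n + g n) \<in> I) \<and>
     (\<forall>c. \<forall>f\<in>I. (\<lambda>n. c *\<^sub>C f n) \<in> I) \<and>
     (\<forall>f\<in>I. \<forall>g\<in>crossed_product. cp_mult \<sigma> f g \<in> I \<and> cp_mult \<sigma> g f \<in> I)"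

lemma topspace_gelfand_topology: "topspace gelfand_topology = character_space"
proof -
  have "character_space = {\<phi> \<in> character_space. gelfand_transform 0 \<phi> \<in> UNIV}"
    by auto
  then show ?thesis
    unfolding gelfand_topology_def topology_generated_by_topspace by blast
qed

lemma continuous_map_gelfand_transform:
  "continuous_map gelfand_topology euclidean (gelfand_transform a)"
  unfolding continuous_map_def topspace_gelfand_topology
  by (auto simp: gelfand_topology_def intro!: topology_generated_by_Basis)

lemma gelfand_topology_weakest:
  assumes "topspace T = character_space"
    and "\<And>a. continuous_map T euclidean (gelfand_transform a)"
    and "openin gelfand_topology U"
  shows "openin T U"
proof -
  have "generate_topology_on {{\<phi> \<in> character_space. gelfand_transform a \<phi> \<in> V} | a V. open V} U"
    using assms(3) unfolding gelfand_topology_def by (simp add: openin_topology_generated_by_iff)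
  then show ?thesis
  proof induction
    case (Basis s)
    then show ?case
      using assms(1,2) by (auto simp: continuous_map_def)
  qed auto
qed

end

theory Submission
  imports Defs
begin

text \<open>
  For \<open>a \<in> A\<close> the commutator of an element \<open>f\<close> with \<open>a \<delta>\<^sup>0\<close> has the coefficients
  \<open>f\<^sub>n (\<sigma>\<^sup>n(a) - a)\<close>. It is therefore supported inside the support of \<open>f\<close>, and since \<open>A\<close> is
  commutative its coefficient at \<open>0\<close> vanishes. So if \<open>f\<close> lies in the ideal \<open>I\<close>, if \<open>f\<^sub>0 \<noteq> 0\<close>, and
  if no non-zero element of \<open>I\<close> has smaller support than \<open>f\<close>, then all these commutators are
  elements of \<open>I\<close> with strictly smaller support, hence zero, and \<open>f\<close> is in the commutant of \<open>A\<close>.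

  To find such an \<open>f\<close>, take any non-zero element of \<open>I\<close> whose support is as small as possible, and
  let \<open>n\<close> be in its support. Right multiplication by the monomial \<open>b \<delta>\<^sup>-\<^sup>n\<close> shifts the support by \<open>-n\<close> and never
  enlarges it; the new coefficient at \<open>0\<close> is \<open>f\<^sub>n \<sigma>\<^sup>n(b)\<close>. Choosing \<open>b\<close> with \<open>\<sigma>\<^sup>n(b) = f\<^sub>n\<close> makes this
  coefficient \<open>f\<^sub>n\<^sup>2\<close>, which is non-zero because a semi-simple commutative algebra has no non-zero
  nilpotents (lemma \<open>semisimple_square_eq_0\<close>). This choice of \<open>b\<close> replaces the multiplication by
  \<open>\<delta>\<^sup>-\<^sup>n\<close>, which would need a unit in \<open>A\<close>.
\<close>

text \<open>
  Characters take values in a field, so they all vanish on an element of square zero, and such an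
  element has the same Gelfand transform as \<open>0\<close>.
\<close>

lemma semisimple_square_eq_0:
  fixes a :: "'a::complex_comm_banach_algebra"
  assumes "semisimple TYPE('a)" and "a * a = 0"
  shows "a = 0"
proof -
  have "\<phi> a = \<phi> 0" if "\<phi> \<in> character_space" for \<phi> :: "'a \<Rightarrow> complex"
  proof -
    have "\<phi> (0 + 0) = \<phi> 0 + \<phi> 0" and "\<phi> (a * a) = \<phi> a * \<phi> a"
      using that unfolding character_space_def by blast+
    then show ?thesis
      using assms(2) by simp
  qed
  then have "gelfand_transform a = gelfand_transform (0::'a)"
    unfolding gelfand_transform_def by (intro restrict_ext) blast
  then show ?thesis
    using assms(1) unfolding semisimple_def by (rule injD[rotated])
qed

lemma scaleC_minus_one: "(-1) *\<^sub>C x = - x"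
  for x :: "'a::complex_comm_banach_algebra"
  using scaleR_scaleC[of "-1" x] by simp

lemma algebra_automorphism_zero:
  assumes "algebra_automorphism \<sigma>"
  shows "\<sigma> 0 = 0"
proof -
  have "\<sigma> (0 + 0) = \<sigma> 0 + \<sigma> 0"
    using assms unfolding algebra_automorphism_def by blast
  then show ?thesis by simp
qed

lemma int_iterate_fixpoint:
  assumes "bij \<sigma>" and "\<sigma> x = x"
  shows "int_iterate \<sigma> k x = x"
proof -
  have inv: "inv \<sigma> x = x"
    using assms by (metis bij_inv_eq_iff)
  have "(\<tau> ^^ m) x = x" if "\<tau> x = x" for \<tau> :: "'a \<Rightarrow> 'a" and m
    using that by (induction m) auto
  then show ?thesis
    using assms(2) inv by (simp add: int_iterate_def)
qed

lemma surj_int_iterate: "bij \<sigma> \<Longrightarrow> surj (int_iterate \<sigma> k)"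
  unfolding int_iterate_def
  by (simp add: bij_betw_imp_surj_on bij_imp_bij_inv bij_fn bij_is_surj)

definition cp_monomial :: "int \<Rightarrow> 'a::complex_comm_banach_algebra \<Rightarrow> int \<Rightarrow> 'a" where
  "cp_monomial m b = (\<lambda>n. if n = m then b else 0)"

lemma cp_embed_eq_monomial: "cp_embed a = cp_monomial 0 a"
  unfolding cp_embed_def cp_monomial_def ..

lemma cp_monomial_in_crossed_product: "cp_monomial m b \<in> crossed_product"
proof -
  have "{n. cp_monomial m b n \<noteq> 0} \<subseteq> {m}"
    by (auto simp: cp_monomial_def)
  then show ?thesis
    unfolding crossed_product_def using finite_subset by blast
qed

lemma cp_ideal_mult_monomial:
  assumes "cp_ideal \<sigma> I" and "f \<in> I"
  shows "cp_mult \<sigma> f (cp_monomial m b) \<in> I" and "cp_mult \<sigma> (cp_monomial m b) f \<in> I"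
  using assms cp_monomial_in_crossed_product[of m b] by (simp_all add: cp_ideal_def)

lemma cp_mult_monomial_right:
  assumes "algebra_automorphism \<sigma>" and "f \<in> crossed_product"
  shows "cp_mult \<sigma> f (cp_monomial m b) n = f (n - m) * int_iterate \<sigma> (n - m) b"
proof -
  have bij: "bij \<sigma>"
    using assms(1) by (simp add: algebra_automorphism_def)
  have zero: "int_iterate \<sigma> k 0 = 0" for k
    using int_iterate_fixpoint[OF bij] algebra_automorphism_zero[OF assms(1)] by blast
  have fin: "finite {k. f k \<noteq> 0}"
    using assms(2) by (simp add: crossed_product_def)
  have "cp_mult \<sigma> f (cp_monomial m b) n =
      (\<Sum>k | f k \<noteq> 0. if k = n - m then f k * int_iterate \<sigma> k b else 0)"
    unfolding cp_mult_def cp_monomial_def by (intro sum.cong) (auto simp: zero)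
  then show ?thesis
    using fin by simp
qed

lemma cp_mult_embed_left: "cp_mult \<sigma> (cp_embed a) f n = a * f n"
proof (cases "a = 0")
  case True
  then show ?thesis by (simp add: cp_mult_def cp_embed_def)
next
  case False
  then have "{k. cp_embed a k \<noteq> 0} = {0}"
    by (auto simp: cp_embed_def)
  then show ?thesis
    by (simp add: cp_mult_def cp_embed_def int_iterate_def)
qed

lemma cp_mult_embed_right:
  assumes "algebra_automorphism \<sigma>" and "f \<in> crossed_product"
  shows "cp_mult \<sigma> f (cp_embed a) n = f n * int_iterate \<sigma> n a"
  using cp_mult_monomial_right[OF assms, of 0 a n] by (simp add: cp_embed_eq_monomial)

text \<open>
  The commutator of \<open>g\<close> with \<open>a \<delta>\<^sup>0\<close> always loses the coefficient at \<open>0\<close> and gains none elsewhere.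
  When \<open>g 0 \<noteq> 0\<close> its support is thus strictly smaller, which minimality permits only for zero.
\<close>

lemma minimal_support_in_commutant:
  assumes "algebra_automorphism \<sigma>" and ideal: "cp_ideal \<sigma> I"
    and "g \<in> I" and "g 0 \<noteq> 0"
    and minimal: "\<And>h. h \<in> I \<Longrightarrow> h \<noteq> (\<lambda>_. 0) \<Longrightarrow> card {n. g n \<noteq> 0} \<le> card {n. h n \<noteq> 0}"
  shows "g \<in> cp_commutant \<sigma>"
proof -
  have g: "g \<in> crossed_product"
    using ideal \<open>g \<in> I\<close> by (auto simp: cp_ideal_def)
  have "cp_mult \<sigma> g (cp_embed a) = cp_mult \<sigma> (cp_embed a) g" for a
  proof -
    define h where "h = (\<lambda>n. cp_mult \<sigma> g (cp_embed a) n + (-1) *\<^sub>C cp_mult \<sigma> (cp_embed a) g n)"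
    have "cp_mult \<sigma> g (cp_embed a) \<in> I" "cp_mult \<sigma> (cp_embed a) g \<in> I"
      using cp_ideal_mult_monomial[OF ideal \<open>g \<in> I\<close>] by (simp_all add: cp_embed_eq_monomial)
    then have "h \<in> I"
      using ideal by (simp add: h_def cp_ideal_def)
    have h_eq: "h n = g n * int_iterate \<sigma> n a - a * g n" for n
      by (simp add: h_def cp_mult_embed_left cp_mult_embed_right[OF assms(1) g] scaleC_minus_one)
    then have "h 0 = 0"
      by (simp add: int_iterate_def mult.commute)
    moreover have "{n. h n \<noteq> 0} \<subseteq> {n. g n \<noteq> 0}"
      by (auto simp: h_eq)
    ultimately have "{n. h n \<noteq> 0} \<subset> {n. g n \<noteq> 0}"
      using \<open>g 0 \<noteq> 0\<close> by blast
    then have "card {n. h n \<noteq> 0} < card {n. g n \<noteq> 0}"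
      using g by (simp add: crossed_product_def psubset_card_mono)
    with minimal[OF \<open>h \<in> I\<close>] have "h = (\<lambda>_. 0)"
      by fastforce
    then show ?thesis
      by (auto simp: h_def scaleC_minus_one fun_eq_iff)
  qed
  with g show ?thesis
    by (simp add: cp_commutant_def)
qed

text \<open>
  Normalizes an element of an ideal to have a non-zero coefficient at \<open>0\<close>. Multiplying by a
  monomial can only shift the support and delete points from it, so minimality of the support
  survives.
\<close>

lemma ideal_shift_to_zero:
  fixes \<sigma> :: "'a::complex_comm_banach_algebra \<Rightarrow> 'a"
  assumes "semisimple TYPE('a)" and "algebra_automorphism \<sigma>" and ideal: "cp_ideal \<sigma> I"
    and "f \<in> I" and "f \<noteq> (\<lambda>_. 0)"
  obtains g where "g \<in> I" and "g 0 \<noteq> 0" and "card {n. g n \<noteq> 0} \<le> card {n. f n \<noteq> 0}"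
proof -
  have f: "f \<in> crossed_product"
    using ideal \<open>f \<in> I\<close> by (auto simp: cp_ideal_def)
  obtain m where "f m \<noteq> 0"
    using \<open>f \<noteq> (\<lambda>_. 0)\<close> by auto
  have "surj (int_iterate \<sigma> m)"
    using assms(2) by (intro surj_int_iterate) (simp add: algebra_automorphism_def)
  then obtain b where b: "int_iterate \<sigma> m b = f m"
    by (metis surjD)
  define g where "g = cp_mult \<sigma> f (cp_monomial (- m) b)"
  have g_eq: "g n = f (n + m) * int_iterate \<sigma> (n + m) b" for n
    using cp_mult_monomial_right[OF assms(2) f, of "- m" b n] by (simp add: g_def)
  show thesis
  proof
    show "g \<in> I"
      unfolding g_def using cp_ideal_mult_monomial(1)[OF ideal \<open>f \<in> I\<close>] .
    show "g 0 \<noteq> 0"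
      using semisimple_square_eq_0[OF assms(1), of "f m"] \<open>f m \<noteq> 0\<close> by (auto simp: g_eq b)
    have "{n. g n \<noteq> 0} \<subseteq> (\<lambda>n. n - m) ` {n. f n \<noteq> 0}"
    proof
      fix n
      assume "n \<in> {n. g n \<noteq> 0}"
      then have "n + m \<in> {n. f n \<noteq> 0}"
        by (auto simp: g_eq)
      then show "n \<in> (\<lambda>n. n - m) ` {n. f n \<noteq> 0}"
        by (rule rev_image_eqI) simp
    qed
    then show "card {n. g n \<noteq> 0} \<le> card {n. f n \<noteq> 0}"
      using f by (intro surj_card_le) (simp_all add: crossed_product_def)
  qed
qed

theorem theorem6p1:
  fixes \<sigma> :: "'a::complex_comm_banach_algebra \<Rightarrow> 'a"
    and I :: "(int \<Rightarrow> 'a) set"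
  assumes "semisimple TYPE('a)"
    and "regular TYPE('a)"
    and "algebra_automorphism \<sigma>"
    and "cp_ideal \<sigma> I"
    and "I \<noteq> {\<lambda>_. 0}"
  shows "I \<inter> cp_commutant \<sigma> \<noteq> {\<lambda>_. 0}"
proof -
  have "(\<lambda>_. 0) \<in> I"
    using assms(4) by (simp add: cp_ideal_def)
  then obtain f\<^sub>0 where "f\<^sub>0 \<in> I \<and> f\<^sub>0 \<noteq> (\<lambda>_. 0)"
    using assms(5) by blast
  from ex_has_least_nat[where P = "\<lambda>h. h \<in> I \<and> h \<noteq> (\<lambda>_. 0)", OF this, of "\<lambda>h. card {n. h n \<noteq> 0}"]
  obtain f where f: "f \<in> I" "f \<noteq> (\<lambda>_. 0)"
    and f_minimal: "\<And>h. h \<in> I \<Longrightarrow> h \<noteq> (\<lambda>_. 0) \<Longrightarrow> card {n. f n \<noteq> 0} \<le> card {n. h n \<noteq> 0}"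
    by blast
  obtain g where g: "g \<in> I" "g 0 \<noteq> 0" "card {n. g n \<noteq> 0} \<le> card {n. f n \<noteq> 0}"
    using ideal_shift_to_zero[OF assms(1,3,4) f] .
  have "g \<in> cp_commutant \<sigma>"
    using minimal_support_in_commutant[OF assms(3,4) g(1,2)] order_trans[OF g(3) f_minimal] by blast
  with g(1) have "g \<in> I \<inter> cp_commutant \<sigma>"
    by blast
  with g(2) show ?thesis
    by force
qed

end
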